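(* Let $B \in \mathbb{N}_{>1}$. The image of $(\mathrm{DF}_B(p))_{p \in \mathbb{P}}$ in $\mathcal{A}$ is naively transcendental, where $\mathrm{DF}_B(p)$ denotes the digit flip of $p$ in base $B$.
   Context: $\mathbb{N}$ is the set of non-negative integers, $\mathbb{P}$ is the set of prime numbers, and $\mathbb{F}_p = \mathbb{Z}/p\mathbb{Z}$. Set $\mathcal{A} := \prod_{p \in \mathbb{P}} \mathbb{F}_p \big/ \bigoplus_{p \in \mathbb{P}} \mathbb{F}_p$, which is a $\mathbb{Q}$-algebra (every nonzero integer is invertible modulo all but finitely many primes). For a map $a \colon \mathbb{P} \to \mathbb{N}$, the image of $a$ in $\mathcal{A}$ is the class of $(a(p) + p\mathbb{Z})_{p \in \mathbb{P}}$. An element $\alpha \in \mathcal{A}$ is naively transcendental if there is no $F \in \mathbb{Q}[x] \setminus \{0\}$ with $F(\alpha) = 0$ in $\mathcal{A}$. For $n \in \mathbb{N}_{>0}$, write $n = \sum_{d=0}^{D} a(d) B^d$ in base $B$, with $D \in \mathbb{N}$, digits $a(d) \in \{0, \dots, B-1\}$ for $0 \le d \le D$, and $a(D) \neq 0$. The digit flip of $n$ in base $B$ is $\mathrm{DF}_B(n) := \sum_{d=0}^{D} (B - 1 - a(d)) B^d$. *)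

theory Defs
  imports
    "HOL-Algebra.UnivPoly"
    "HOL-Algebra.Algebraic_Closure_Type"
    "HOL-Number_Theory.Number_Theory"
    "HOL-Library.Log_Nat"
begin

hide_const (open) Divisibility.prime

definition ring_product :: "'i set \<Rightarrow> ('i \<Rightarrow> 'a ring) \<Rightarrow> ('i \<Rightarrow> 'a) ring" where
  "ring_product I R =
    \<lparr>carrier = (\<Pi>\<^sub>E i\<in>I. carrier (R i)),
     monoid.mult = (\<lambda>f g. \<lambda>i\<in>I. f i \<otimes>\<^bsub>R i\<^esub> g i),
     one = (\<lambda>i\<in>I. \<one>\<^bsub>R i\<^esub>),
     ring.zero = (\<lambda>i\<in>I. \<zero>\<^bsub>R i\<^esub>),
     ring.add = (\<lambda>f g. \<lambda>i\<in>I. f i \<oplus>\<^bsub>R i\<^esub> g i)\<rparr>"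

definition ring_direct_sum :: "'i set \<Rightarrow> ('i \<Rightarrow> 'a ring) \<Rightarrow> ('i \<Rightarrow> 'a) set" where
  "ring_direct_sum I R =
    {f \<in> carrier (ring_product I R). finite {i \<in> I. f i \<noteq> \<zero>\<^bsub>R i\<^esub>}}"

lemma cring_ring_product:
  assumes "\<And>i. i \<in> I \<Longrightarrow> cring (R i)"
  shows "cring (ring_product I R)"
proof (rule cringI)
  note [simp] = ring_product_def
  have m: "i \<in> I \<Longrightarrow> ring (R i)" for i
    using assms cring.axioms(1) by blast
  note ab = ring.is_abelian_group[OF m]
  note am = abelian_group.axioms(1)[OF ab]
  note mon = ring.is_monoid[OF m]
  show "abelian_group (ring_product I R)"
  proof (rule abelian_groupI)
    fix x assume x: "x \<in> carrier (ring_product I R)"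
    show "\<exists>y\<in>carrier (ring_product I R). y \<oplus>\<^bsub>ring_product I R\<^esub> x = \<zero>\<^bsub>ring_product I R\<^esub>"
      using x by (intro bexI[of _ "\<lambda>i\<in>I. \<ominus>\<^bsub>R i\<^esub> x i"])
        (auto simp: fun_eq_iff restrict_def abelian_group.a_inv_closed[OF ab]
           abelian_group.l_neg[OF ab] PiE_iff extensional_def)
  qed (auto simp: fun_eq_iff PiE_iff restrict_def extensional_def
         abelian_monoid.a_closed[OF am] abelian_monoid.zero_closed[OF am]
         abelian_monoid.l_zero[OF am]
         intro: abelian_monoid.a_assoc[OF am] abelian_monoid.a_comm[OF am])
  show "Group.comm_monoid (ring_product I R)"
    by (rule comm_monoidI)
      (auto simp: fun_eq_iff PiE_iff restrict_def extensional_def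
         monoid.m_closed[OF mon] monoid.one_closed[OF mon] monoid.l_one[OF mon]
         intro: monoid.m_assoc[OF mon] comm_monoid.m_comm[OF cring.axioms(2)[OF assms]])
qed (auto simp: ring_product_def fun_eq_iff PiE_iff restrict_def
       ring.ring_simprules(13)[OF cring.axioms(1)[OF assms]])

lemma a_inv_ring_product:
  assumes R: "\<And>i. i \<in> I \<Longrightarrow> cring (R i)" and x: "x \<in> carrier (ring_product I R)"
  shows "\<ominus>\<^bsub>ring_product I R\<^esub> x = (\<lambda>i\<in>I. \<ominus>\<^bsub>R i\<^esub> x i)"
proof -
  have ab: "i \<in> I \<Longrightarrow> abelian_group (R i)" for i
    using R by (metis cring.axioms(1) ring.is_abelian_group)
  show ?thesis
  proof (rule abelian_group.minus_equality)
    show "abelian_group (ring_product I R)"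
      using cring_ring_product[of I R] R by (metis cring.axioms(1) ring.is_abelian_group)
  qed (use x in \<open>auto simp: ring_product_def fun_eq_iff restrict_def PiE_iff
        abelian_group.a_inv_closed[OF ab] abelian_group.l_neg[OF ab] extensional_def\<close>)
qed

lemma ideal_ring_direct_sum:
  assumes R: "\<And>i. i \<in> I \<Longrightarrow> cring (R i)"
  shows "ideal (ring_direct_sum I R) (ring_product I R)"
proof -
  interpret P: cring "ring_product I R" by (rule cring_ring_product[OF R])
  have rg: "i \<in> I \<Longrightarrow> ring (R i)" for i
    using R cring.axioms(1) by blast
  note ab = ring.is_abelian_group[OF rg]
  note am = abelian_group.axioms(1)[OF ab]
  have comp: "x i \<in> carrier (R i)" if "x \<in> carrier (ring_product I R)" "i \<in> I" for x i
    using that by (auto simp: ring_product_def)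
  have fin: "f \<in> ring_direct_sum I R"
    if "f \<in> carrier (ring_product I R)" "finite S"
      "\<And>i. i \<in> I \<Longrightarrow> i \<notin> S \<Longrightarrow> f i = \<zero>\<^bsub>R i\<^esub>" for f S
    using that unfolding ring_direct_sum_def by (auto intro: finite_subset[of _ S])
  let ?s = "\<lambda>f. {i \<in> I. f i \<noteq> \<zero>\<^bsub>R i\<^esub>}"
  show ?thesis
  proof (rule idealI)
    show "ring (ring_product I R)" by (rule P.ring_axioms)
    show "subgroup (ring_direct_sum I R) (add_monoid (ring_product I R))"
    proof (rule P.add.subgroupI)
      show "ring_direct_sum I R \<subseteq> carrier (ring_product I R)"
        by (auto simp: ring_direct_sum_def)
      have "\<zero>\<^bsub>ring_product I R\<^esub> \<in> ring_direct_sum I R"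
        by (rule fin[of _ "{}"]) (simp_all, simp add: ring_product_def)
      then show "ring_direct_sum I R \<noteq> {}" by blast
    next
      fix a assume a: "a \<in> ring_direct_sum I R"
      then have ac: "a \<in> carrier (ring_product I R)" by (simp add: ring_direct_sum_def)
      have *: "\<ominus>\<^bsub>ring_product I R\<^esub> a = (\<lambda>i\<in>I. \<ominus>\<^bsub>R i\<^esub> a i)"
        using R ac by (rule a_inv_ring_product)
      have "\<ominus>\<^bsub>ring_product I R\<^esub> a \<in> ring_direct_sum I R"
      proof (rule fin[of _ "?s a"])
        show "\<ominus>\<^bsub>ring_product I R\<^esub> a \<in> carrier (ring_product I R)" using ac by simp
        show "finite (?s a)" using a by (simp add: ring_direct_sum_def)
        fix i assume i: "i \<in> I" "i \<notin> ?s a"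
        interpret Ri: ring "R i" using rg i by blast
        show "(\<ominus>\<^bsub>ring_product I R\<^esub> a) i = \<zero>\<^bsub>R i\<^esub>" using i by (simp add: *)
      qed
      then show "\<ominus>\<^bsub>ring_product I R\<^esub> a \<in> ring_direct_sum I R" .
    next
      fix a b assume a: "a \<in> ring_direct_sum I R" and b: "b \<in> ring_direct_sum I R"
      show "a \<oplus>\<^bsub>ring_product I R\<^esub> b \<in> ring_direct_sum I R"
      proof (rule fin[of _ "?s a \<union> ?s b"])
        show "a \<oplus>\<^bsub>ring_product I R\<^esub> b \<in> carrier (ring_product I R)"
          using a b by (simp add: ring_direct_sum_def)
        show "finite (?s a \<union> ?s b)" using a b by (simp add: ring_direct_sum_def)
        fix i assume i: "i \<in> I" "i \<notin> ?s a \<union> ?s b"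
        interpret Ri: ring "R i" using rg i by blast
        show "(a \<oplus>\<^bsub>ring_product I R\<^esub> b) i = \<zero>\<^bsub>R i\<^esub>"
          using i by (simp add: ring_product_def)
      qed
    qed
  next
    fix a x assume a: "a \<in> ring_direct_sum I R" and x: "x \<in> carrier (ring_product I R)"
    have ac: "a \<in> carrier (ring_product I R)" using a by (simp add: ring_direct_sum_def)
    show "x \<otimes>\<^bsub>ring_product I R\<^esub> a \<in> ring_direct_sum I R"
    proof (rule fin[of _ "?s a"])
      show "x \<otimes>\<^bsub>ring_product I R\<^esub> a \<in> carrier (ring_product I R)" using ac x by simp
      show "finite (?s a)" using a by (simp add: ring_direct_sum_def)
      fix i assume i: "i \<in> I" "i \<notin> ?s a"
      interpret Ri: ring "R i" using rg i by blast
      show "(x \<otimes>\<^bsub>ring_product I R\<^esub> a) i = \<zero>\<^bsub>R i\<^esub>"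
        using i comp[OF x] by (simp add: ring_product_def)
    qed
    then show "a \<otimes>\<^bsub>ring_product I R\<^esub> x \<in> ring_direct_sum I R"
      using P.m_comm[OF ac x] by simp
  qed
qed

definition prime_fields_prod :: "(nat \<Rightarrow> int) ring" where
  "prime_fields_prod = ring_product {p. prime p} (\<lambda>p. residue_ring (int p))"

definition prime_fields_sum :: "(nat \<Rightarrow> int) set" where
  "prime_fields_sum = ring_direct_sum {p. prime p} (\<lambda>p. residue_ring (int p))"

definition ring_A :: "(nat \<Rightarrow> int) set ring" where
  "ring_A = prime_fields_prod Quot prime_fields_sum"

text \<open>
  The carrier of \<^const>\<open>residue_ring\<close> consists of the representatives
  \<open>0, \<dots>, p - 1\<close>, so an integer enters the factor at \<open>p\<close> as its remainder.
\<close>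

definition class_A :: "(nat \<Rightarrow> int) \<Rightarrow> (nat \<Rightarrow> int) set" where
  "class_A a = prime_fields_sum +>\<^bsub>prime_fields_prod\<^esub> (\<lambda>p\<in>{p. prime p}. a p mod int p)"

definition image_A :: "(nat \<Rightarrow> nat) \<Rightarrow> (nat \<Rightarrow> int) set" where
  "image_A a = class_A (\<lambda>p. int (a p))"

abbreviation rat_ring :: "rat ring" where
  "rat_ring \<equiv> ring_of_type_algebra"

text \<open>
  The structure map of the \<open>\<rat>\<close>-algebra. The rational \<open>a / b\<close> in lowest terms is sent to the
  family of the \<open>a b\<^sup>-\<^sup>1\<close> modulo \<open>p\<close>; at the finitely many primes dividing \<open>b\<close> the
  value of \<^const>\<open>modular_inverse\<close> is \<open>0\<close>, which does not affect the class.
\<close>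

definition rat_to_A :: "rat \<Rightarrow> (nat \<Rightarrow> int) set" where
  "rat_to_A q = (case quotient_of q of (a, b) \<Rightarrow>
     class_A (\<lambda>p. a * modular_inverse (int p) b))"

definition naively_transcendental :: "(nat \<Rightarrow> int) set \<Rightarrow> bool" where
  "naively_transcendental \<alpha> \<longleftrightarrow> \<alpha> \<in> carrier ring_A \<and>
     \<not> (\<exists>F \<in> carrier (UP rat_ring) - {\<zero>\<^bsub>UP rat_ring\<^esub>}.
           UnivPoly.eval rat_ring ring_A rat_to_A \<alpha> F = \<zero>\<^bsub>ring_A\<^esub>)"

lemma cring_residue_ring_prime: "prime p \<Longrightarrow> cring (residue_ring (int p))"
  by (intro residues.cring residues.intro) (use prime_gt_1_nat[of p] in simp)

lemma cring_prime_fields_prod: "cring prime_fields_prod"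
  unfolding prime_fields_prod_def
  by (rule cring_ring_product) (simp add: cring_residue_ring_prime)

lemma ideal_prime_fields_sum: "ideal prime_fields_sum prime_fields_prod"
  unfolding prime_fields_prod_def prime_fields_sum_def
  by (rule ideal_ring_direct_sum) (simp add: cring_residue_ring_prime)

lemma cring_ring_A: "cring ring_A"
  unfolding ring_A_def
  by (rule ideal.quotient_is_cring[OF ideal_prime_fields_sum cring_prime_fields_prod])

lemma family_closed:
  "(\<lambda>p\<in>{p. prime p}. a p mod int p) \<in> carrier prime_fields_prod"
  by (auto simp: prime_fields_prod_def ring_product_def residue_ring_def
      prime_gt_0_nat)

lemma class_A_closed: "class_A a \<in> carrier ring_A"
  unfolding class_A_def ring_A_def
  by (rule ring_hom_closed[OF ideal.rcos_ring_hom[OF ideal_prime_fields_sum] family_closed])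

lemma class_A_add: "class_A a \<oplus>\<^bsub>ring_A\<^esub> class_A b = class_A (\<lambda>p. a p + b p)"
proof -
  have "(\<lambda>p\<in>{p. prime p}. a p mod int p) \<oplus>\<^bsub>prime_fields_prod\<^esub>
        (\<lambda>p\<in>{p. prime p}. b p mod int p) = (\<lambda>p\<in>{p. prime p}. (a p + b p) mod int p)"
    by (auto simp: prime_fields_prod_def ring_product_def residue_ring_def fun_eq_iff mod_add_eq)
  then show ?thesis
    unfolding class_A_def ring_A_def
    by (simp flip: ring_hom_add[OF ideal.rcos_ring_hom[OF ideal_prime_fields_sum]
          family_closed family_closed])
qed

lemma class_A_mult: "class_A a \<otimes>\<^bsub>ring_A\<^esub> class_A b = class_A (\<lambda>p. a p * b p)"
proof -
  have "(\<lambda>p\<in>{p. prime p}. a p mod int p) \<otimes>\<^bsub>prime_fields_prod\<^esub>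
        (\<lambda>p\<in>{p. prime p}. b p mod int p) = (\<lambda>p\<in>{p. prime p}. (a p * b p) mod int p)"
    by (auto simp: prime_fields_prod_def ring_product_def residue_ring_def fun_eq_iff mod_mult_eq)
  then show ?thesis
    unfolding class_A_def ring_A_def
    by (simp flip: ring_hom_mult[OF ideal.rcos_ring_hom[OF ideal_prime_fields_sum]
          family_closed family_closed])
qed

lemma class_A_one: "class_A (\<lambda>p. 1) = \<one>\<^bsub>ring_A\<^esub>"
proof -
  have "(\<lambda>p\<in>{p. prime p}. 1 mod int p) = \<one>\<^bsub>prime_fields_prod\<^esub>"
    by (auto simp: prime_fields_prod_def ring_product_def residue_ring_def fun_eq_iff
        dest: prime_gt_1_nat)
  then show ?thesis
    by (simp add: class_A_def ring_A_def FactRing_def)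
qed

lemma class_A_eq_iff:
  "class_A a = class_A b \<longleftrightarrow> finite {p. prime p \<and> \<not> [a p = b p] (mod int p)}"
proof -
  interpret I: ideal prime_fields_sum prime_fields_prod by (rule ideal_prime_fields_sum)
  let ?f = "\<lambda>a. (\<lambda>p\<in>{p. prime p}. a p mod int p)"
  have R: "cring (residue_ring (int p))" if "p \<in> {p. prime p}" for p
    using that by (simp add: cring_residue_ring_prime)
  have neg: "(\<ominus>\<^bsub>prime_fields_prod\<^esub> ?f b) = ?f (\<lambda>p. - b p)"
  proof (rule I.minus_equality)
    show "?f (\<lambda>p. - b p) \<oplus>\<^bsub>prime_fields_prod\<^esub> ?f b = \<zero>\<^bsub>prime_fields_prod\<^esub>"
      by (auto simp: prime_fields_prod_def ring_product_def residue_ring_def fun_eq_iff mod_add_eq)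
  qed (rule family_closed)+
  have diff: "?f a \<ominus>\<^bsub>prime_fields_prod\<^esub> ?f b = ?f (\<lambda>p. a p - b p)"
    unfolding a_minus_def neg
    by (auto simp: prime_fields_prod_def ring_product_def residue_ring_def fun_eq_iff mod_add_eq)
  have "class_A a = class_A b \<longleftrightarrow> ?f a \<ominus>\<^bsub>prime_fields_prod\<^esub> ?f b \<in> prime_fields_sum"
    unfolding class_A_def
    by (rule I.quotient_eq_iff_same_a_r_cos[symmetric])
      (rule ideal_prime_fields_sum family_closed)+
  also have "\<dots> \<longleftrightarrow> finite {p. prime p \<and> \<not> [a p = b p] (mod int p)}"
    using family_closed[of "\<lambda>p. a p - b p"] unfolding diff
    by (auto simp: prime_fields_sum_def ring_direct_sum_def prime_fields_prod_def
        residue_ring_def cong_iff_dvd_diff mod_eq_0_iff_dvd elim!: rev_finite_subset)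
  finally show ?thesis .
qed

lemma finite_prime_dvd: "b \<noteq> 0 \<Longrightarrow> finite {p::nat. prime p \<and> int p dvd b}"
  by (rule finite_subset[of _ "{..nat \<bar>b\<bar>}"]) (auto dest: dvd_imp_le_int)

lemma rat_to_A_eqI:
  assumes "b \<noteq> 0" "q = of_int a / of_int b" and "finite S"
    and "\<And>p. prime p \<Longrightarrow> p \<notin> S \<Longrightarrow> [c p * b = a] (mod int p)"
  shows "rat_to_A q = class_A c"
proof -
  obtain n d where nd: "quotient_of q = (n, d)" by fastforce
  have d: "d > 0" "q = of_int n / of_int d"
    using quotient_of_denom_pos[OF nd] quotient_of_div[OF nd] by auto
  have "of_int (n * b) = (of_int (a * d) :: rat)"
    using assms(1,2) d by (simp add: field_simps)
  then have nb: "n * b = a * d" by (simp only: of_int_eq_iff)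
  have "[n * modular_inverse (int p) d = c p] (mod int p)"
    if p: "prime p" "p \<notin> S" "\<not> int p dvd b" "\<not> int p dvd d" for p
  proof -
    have cop: "coprime (int p) b" "coprime (int p) d"
      using p by (auto intro: prime_imp_coprime)
    have inv: "[ modular_inverse (int p) d * d = 1] (mod int p)"
      using cop by (intro cong_modular_inverse2) (simp add: coprime_commute)
    have "[n * modular_inverse (int p) d * (b * d) = n * b * (modular_inverse (int p) d * d)] (mod int p)"
      by (simp add: mult_ac)
    also have "[n * b * (modular_inverse (int p) d * d) = n * b * 1] (mod int p)"
      by (intro cong_mult cong_refl inv)
    also have "n * b * 1 = a * d" using nb by simp
    also have "[a * d = c p * b * d] (mod int p)"
      by (intro cong_mult cong_refl cong_sym[OF assms(4)] p)
    finally have "[n * modular_inverse (int p) d * (b * d) = c p * (b * d)] (mod int p)"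
      by (simp add: mult_ac)
    then show ?thesis
      using cop by (subst (asm) cong_mult_rcancel) (simp_all add: coprime_commute)
  qed
  then have "{p. prime p \<and> \<not> [n * modular_inverse (int p) d = c p] (mod int p)}
      \<subseteq> S \<union> {p. prime p \<and> int p dvd b} \<union> {p. prime p \<and> int p dvd d}"
    by blast
  moreover have "finite \<dots>"
    using assms(1,3) d(1) by (simp add: finite_prime_dvd)
  ultimately show ?thesis
    unfolding rat_to_A_def nd prod.case class_A_eq_iff by (rule finite_subset)
qed

lemma rat_to_A_ring_hom: "rat_to_A \<in> ring_hom rat_ring ring_A"
proof -
  define den where "den q = snd (quotient_of q)" for q
  define num where "num q = fst (quotient_of q)" for q
  define c where "c q p = num q * modular_inverse (int p) (den q)" for q and p :: nat
  define S where "S q = {p::nat. prime p \<and> int p dvd den q}" for q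
  have rep: "rat_to_A q = class_A (c q)" for q
    by (simp add: rat_to_A_def c_def[abs_def] num_def den_def case_prod_beta)
  have pos: "den q > 0" for q
    by (simp add: den_def quotient_of_denom_pos')
  have quo: "q = of_int (num q) / of_int (den q)" for q
    by (simp add: num_def den_def quotient_of_div)
  have fin: "finite (S q)" for q
    unfolding S_def using pos[of q] by (intro finite_prime_dvd) simp
  have cp: "[c q p * den q = num q] (mod int p)" if "prime p" "p \<notin> S q" for p q
  proof -
    have "coprime (den q) (int p)"
      using that by (subst coprime_commute) (auto simp: S_def intro: prime_imp_coprime)
    from cong_mult[OF cong_refl[of "num q"] cong_modular_inverse2[OF this]] show ?thesis
      by (simp add: c_def mult_ac)
  qed
  show ?thesis
  proof (rule ring_hom_memI)
    show "rat_to_A x \<in> carrier ring_A" for x by (simp add: rep class_A_closed)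
    show "rat_to_A \<one>\<^bsub>rat_ring\<^esub> = \<one>\<^bsub>ring_A\<^esub>"
      unfolding class_A_one[symmetric]
      by (rule rat_to_A_eqI[of 1 _ 1 "{}"]) (simp_all add: ring_of_type_algebra_def)
    fix x y
    have nz: "den x * den y \<noteq> 0" using pos[of x] pos[of y] by simp
    then have xy: "x * y = of_int (num x * num y) / of_int (den x * den y)"
      "x + y = of_int (num x * den y + num y * den x) / of_int (den x * den y)"
      using arg_cong2[where f = "(*)", OF quo[of x] quo[of y]]
        arg_cong2[where f = "(+)", OF quo[of x] quo[of y]]
      by (simp_all only: times_divide_times_eq add_frac_eq mult_eq_0_iff of_int_eq_0_iff
          of_int_mult of_int_add not_False_eq_True de_Morgan_disj)
    show "rat_to_A (x \<otimes>\<^bsub>rat_ring\<^esub> y) = rat_to_A x \<otimes>\<^bsub>ring_A\<^esub> rat_to_A y"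
      unfolding rep[of x] rep[of y] class_A_mult
    proof (rule rat_to_A_eqI[OF nz _ finite_UnI[OF fin[of x] fin[of y]]])
      show "x \<otimes>\<^bsub>rat_ring\<^esub> y = of_int (num x * num y) / of_int (den x * den y)"
        using xy(1) by (simp add: ring_of_type_algebra_def)
      fix p :: nat assume p: "prime p" "p \<notin> S x \<union> S y"
      show "[c x p * c y p * (den x * den y) = num x * num y] (mod int p)"
        using cong_mult[OF cp[of p x] cp[of p y]] p by (simp add: mult_ac)
    qed
    show "rat_to_A (x \<oplus>\<^bsub>rat_ring\<^esub> y) = rat_to_A x \<oplus>\<^bsub>ring_A\<^esub> rat_to_A y"
      unfolding rep[of x] rep[of y] class_A_add
    proof (rule rat_to_A_eqI[OF nz _ finite_UnI[OF fin[of x] fin[of y]]])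
      show "x \<oplus>\<^bsub>rat_ring\<^esub> y =
          of_int (num x * den y + num y * den x) / of_int (den x * den y)"
        using xy(2) by (simp add: ring_of_type_algebra_def)
      fix p :: nat assume p: "prime p" "p \<notin> S x \<union> S y"
      have "[c x p * den x * den y + c y p * den y * den x
             = num x * den y + num y * den x] (mod int p)"
        using p by (intro cong_add cong_mult cong_refl cp) auto
      then show "[(c x p + c y p) * (den x * den y)
             = num x * den y + num y * den x] (mod int p)"
        by (simp add: algebra_simps)
    qed
  qed
qed

text \<open>
  For \<open>B > 1\<close> and \<open>n > 0\<close>, the number of base-\<open>B\<close> digits of \<open>n\<close> (with
  nonzero leading digit) is \<open>floorlog B n\<close>, and \<open>n div B ^ d mod B\<close> is the digit at
  position \<open>d\<close>.
\<close>

definition digit_flip :: "nat \<Rightarrow> nat \<Rightarrow> nat" where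
  "digit_flip B n = (\<Sum>d<floorlog B n. (B - 1 - n div B ^ d mod B) * B ^ d)"

lemma digit_sum_less:
  fixes a :: "nat \<Rightarrow> nat"
  assumes "\<And>d. d < k \<Longrightarrow> a d < B"
  shows "(\<Sum>d<k. a d * B ^ d) < B ^ k"
  using assms
proof (induction k)
  case (Suc k)
  have "(\<Sum>d<Suc k. a d * B ^ d) < (a k + 1) * B ^ k"
    using Suc by (simp add: less_SucI)
  also have "\<dots> \<le> B * B ^ k"
    using Suc.prems[of k] by (intro mult_right_mono) auto
  finally show ?case by simp
qed simp

lemma digit_sum_div_mod:
  fixes a :: "nat \<Rightarrow> nat"
  assumes "\<And>d. d < k \<Longrightarrow> a d < B" and "j < k"
  shows "(\<Sum>d<k. a d * B ^ d) div B ^ j mod B = a j"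
proof -
  have B: "B > 0" using assms(1)[OF assms(2)] by simp
  have "(\<Sum>d<k. a d * B ^ d) = (\<Sum>d<j. a d * B ^ d) + (\<Sum>d=j..<k. a d * B ^ d)"
    using assms(2) by (simp add: lessThan_atLeast0 sum.atLeastLessThan_concat)
  also have "(\<Sum>d=j..<k. a d * B ^ d) = a j * B ^ j + (\<Sum>d=Suc j..<k. a d * B ^ d)"
    using assms(2) by (simp add: sum.atLeast_Suc_lessThan)
  also have "(\<Sum>d=Suc j..<k. a d * B ^ d) = B ^ j * (B * (\<Sum>d=Suc j..<k. a d * B ^ (d - Suc j)))"
    unfolding sum_distrib_left
  proof (rule sum.cong[OF refl])
    fix d assume "d \<in> {Suc j..<k}"
    then have "B ^ d = B ^ j * (B * B ^ (d - Suc j))"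
      by (simp flip: power_Suc power_add)
    then show "a d * B ^ d = B ^ j * (B * (a d * B ^ (d - Suc j)))"
      by (simp add: mult_ac)
  qed
  finally have eq: "(\<Sum>d<k. a d * B ^ d) = (\<Sum>d<j. a d * B ^ d) +
      B ^ j * (a j + B * (\<Sum>d=Suc j..<k. a d * B ^ (d - Suc j)))"
    by (simp add: algebra_simps)
  have "(\<Sum>d<j. a d * B ^ d) < B ^ j"
    using assms by (intro digit_sum_less) auto
  then show ?thesis
    unfolding eq using B assms by simp
qed

lemma digit_flip_eq:
  fixes a :: "nat \<Rightarrow> nat"
  assumes n: "n = (\<Sum>d\<le>D. a d * B ^ d)"
    and a: "\<And>d. d \<le> D \<Longrightarrow> a d < B" and "a D \<noteq> 0" and "B > 1"
  shows "digit_flip B n = (\<Sum>d\<le>D. (B - 1 - a d) * B ^ d)"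
proof -
  have lt: "n < B ^ Suc D"
    unfolding n lessThan_Suc_atMost[symmetric] using a by (intro digit_sum_less) auto
  have "B ^ D \<le> a D * B ^ D" using \<open>a D \<noteq> 0\<close> by simp
  also have "\<dots> \<le> n" unfolding n by (intro member_le_sum) auto
  finally have ge: "B ^ D \<le> n" .
  have "floorlog B n = Suc D"
    using lt ge \<open>B > 1\<close> by (intro antisym floorlog_leI floorlog_geI) auto
  moreover have "n div B ^ d mod B = a d" if "d < Suc D" for d
    unfolding n lessThan_Suc_atMost[symmetric] using a that
    by (intro digit_sum_div_mod) auto
  ultimately show ?thesis
    by (simp add: digit_flip_def lessThan_Suc_atMost[symmetric])
qed

end

theory Submission
  imports Defs
begin

text \<open>
  If \<open>p\<close> has \<open>k\<close> digits in base \<open>B\<close>, then its digit flip is \<open>B ^ k - 1 - p\<close>, which is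
  \<open>B ^ k - 1\<close> modulo \<open>p\<close>. An algebraic relation, cleared of denominators, thus gives a nonzero
  integer polynomial \<open>P\<close> such that, for large \<open>k\<close>, every prime with \<open>k\<close> digits divides
  \<open>P (B ^ k - 1)\<close>. This integer is nonzero for large \<open>k\<close> and at most a constant times
  \<open>B ^ (k * degree P)\<close>, so the number of such primes is bounded independently of \<open>k\<close>. Summing over
  \<open>k\<close>, the reciprocals of the primes would then have a finite sum, contradicting Euler's theorem
  (proved by the argument of Erdos).
\<close>

section \<open>The digit flip as a complement\<close>

text \<open>Needed when \<open>k\<close> is the number of digits of \<open>n\<close>, where the
  remainder is \<open>n\<close> itself.\<close>

lemma digit_sum_eq_mod:
  fixes n B :: nat
  shows "(\<Sum>d<k. n div B ^ d mod B * B ^ d) = n mod B ^ k"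
proof (induction k)
  case (Suc k)
  have "n mod B ^ Suc k = B ^ k * (n div B ^ k mod B) + n mod B ^ k"
    by (simp only: power_Suc2 mod_mult2_eq)
  with Suc show ?case by simp
qed simp

text \<open>A digit and its flip add up to \<open>B - 1\<close>, so flip plus number is the number
  with \<open>k\<close> digits \<open>B - 1\<close>.\<close>

lemma digit_flip_add:
  assumes "B > 1" "n > 0"
  shows "digit_flip B n + n + 1 = B ^ floorlog B n"
proof -
  define k where "k = floorlog B n"
  have "digit_flip B n + n = digit_flip B n + (\<Sum>d<k. n div B ^ d mod B * B ^ d)"
    using floorlog_bounds[OF assms(2,1)] by (simp add: digit_sum_eq_mod k_def)
  also have "\<dots> = (\<Sum>d<k. (B - 1) * B ^ d)"
  proof -
    \<comment> \<open>This makes the truncated difference in \<open>digit_flip\<close> a true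
      one.\<close>
    have "n div B ^ d mod B \<le> B - 1" for d
      using assms mod_less_divisor[of B "n div B ^ d"] by linarith
    then show ?thesis
      unfolding digit_flip_def k_def sum.distrib[symmetric] add_mult_distrib[symmetric]
      by (simp only: le_add_diff_inverse2)
  qed
  also have "\<dots> + 1 = B ^ k"
  proof -
    obtain b where "B = Suc b" using assms by (cases B) auto
    then show ?thesis by (induction k) simp_all
  qed
  finally show ?thesis by (simp add: k_def)
qed

section \<open>Divergence of the sum of prime reciprocals\<close>

text \<open>Such an \<open>n\<close> is determined by the set of primes with odd exponent, all below
  \<open>m\<close>, and by its square part, at most \<open>N\<close>.\<close>

lemma card_smooth_le:
  "card {n \<in> {1..N ^ 2}. \<forall>p. prime p \<longrightarrow> p dvd n \<longrightarrow> p < m} \<le> 2 ^ m * (N::nat)"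
proof -
  let ?S = "{n \<in> {1..N ^ 2}. \<forall>p. prime p \<longrightarrow> p dvd n \<longrightarrow> p < m}"
  let ?f = "\<lambda>n. ({p. prime p \<and> odd (multiplicity p n)}, square_part n)"
  have "inj_on ?f ?S"
  proof (rule inj_onI)
    fix a b assume ab: "a \<in> ?S" "b \<in> ?S" "?f a = ?f b"
    have mod2: "multiplicity p a mod 2 = multiplicity p b mod 2" if "prime p" for p
    proof -
      have "p \<in> fst (?f a) \<longleftrightarrow> p \<in> fst (?f b)" using ab(3) by simp
      with that show ?thesis by (simp add: mod2_eq_if)
    qed
    have "squarefree_part a = squarefree_part b"
    proof (rule multiplicity_eq_nat)
      show "squarefree_part a > 0" "squarefree_part b > 0"
        by (simp_all add: zero_less_iff_neq_zero)
    qed (simp add: mod2 prime_multiplicity_squarefree_part)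
    with ab(3) show "a = b" by (auto intro: squarefree_decomposition_unique)
  qed
  moreover have "?f ` ?S \<subseteq> Pow {..<m} \<times> {1..N}"
  proof safe
    fix n p assume n: "n \<in> {1..N\<^sup>2}" "\<forall>p. prime p \<longrightarrow> p dvd n \<longrightarrow> p < m"
      and p: "prime p" "odd (multiplicity p n)"
    show "p < m" using n p by (metis even_zero not_dvd_imp_multiplicity_0)
  next
    fix n assume n: "n \<in> {1..N\<^sup>2}"
    then have "square_part n ^ 2 \<le> n" by (intro dvd_imp_le) auto
    also have "n \<le> N ^ 2" using n by simp
    finally have "square_part n \<le> N" by (rule power2_le_imp_le) simp
    moreover have "square_part n > 0" using n by (simp add: zero_less_iff_neq_zero)
    ultimately show "square_part n \<in> {1..N}" by simp
  qed
  ultimately have "card ?S \<le> card (Pow {..<m} \<times> {1..N})"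
    by (rule card_inj_on_le) auto
  then show ?thesis by (simp add: card_cartesian_product card_Pow)
qed

lemma not_summable_prime_reciprocals:
  "\<not> summable (\<lambda>p::nat. if prime p then 1 / real p else 0)"
proof
  let ?f = "\<lambda>p::nat. if prime p then 1 / real p else 0"
  assume "summable ?f"
  then obtain m where m: "norm (sum ?f {m..<n}) < 1 / 2" for n
    unfolding summable_Cauchy by (metis half_gt_zero order_refl zero_less_one)
  \<comment> \<open>The count below will give \<open>N ^ 2 \<le> 2 ^ m * N + N ^ 2 / 2\<close>, that
    is \<open>N \<le> 2 ^ (m + 1)\<close>; this \<open>N\<close> is twice that bound.\<close>
  define N :: nat where "N = 2 ^ (m + 2)"
  let ?S = "{n \<in> {1..N ^ 2}. \<forall>p. prime p \<longrightarrow> p dvd n \<longrightarrow> p < m}"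
  let ?I = "{p. prime p \<and> m \<le> p \<and> p \<le> N ^ 2}"
  let ?M = "\<lambda>p. {n \<in> {1..N ^ 2}. p dvd n}"
  have fin: "finite ?I" by simp
  \<comment> \<open>A number without a prime factor of at least \<open>m\<close> lies in
    \<open>?S\<close>; the others are multiples of some \<open>p\<close> in \<open>?I\<close>, and
    each \<open>p\<close> has at most \<open>N ^ 2 / p\<close> of them.\<close>
  have "{1..N ^ 2} \<subseteq> ?S \<union> (\<Union>p\<in>?I. ?M p)"
  proof
    fix n assume n: "n \<in> {1..N ^ 2}"
    show "n \<in> ?S \<union> (\<Union>p\<in>?I. ?M p)"
    proof (cases "\<forall>p. prime p \<longrightarrow> p dvd n \<longrightarrow> p < m")
      case False
      then obtain p where p: "prime p" "p dvd n" "m \<le> p" by (auto simp: not_less)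
      moreover have "p \<le> n" using p n by (intro dvd_imp_le) auto
      ultimately show ?thesis using n by auto
    qed (use n in auto)
  qed
  then have "card {1..N ^ 2} \<le> card (?S \<union> (\<Union>p\<in>?I. ?M p))"
    by (intro card_mono) auto
  also have "\<dots> \<le> card ?S + card (\<Union>p\<in>?I. ?M p)" by (rule card_Un_le)
  also have "\<dots> \<le> 2 ^ m * N + (\<Sum>p\<in>?I. card (?M p))"
    by (intro add_mono card_smooth_le card_UN_le fin)
  finally have "real (N ^ 2) \<le> real (2 ^ m * N) + (\<Sum>p\<in>?I. real (card (?M p)))"
    by (simp only: of_nat_le_iff card_atLeastAtMost diff_Suc_1 flip: of_nat_sum of_nat_add)
  also have "(\<Sum>p\<in>?I. real (card (?M p))) \<le> (\<Sum>p\<in>?I. real (N ^ 2) * ?f p)"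
  proof (rule sum_mono)
    fix p assume p: "p \<in> ?I"
    have "?M p \<subseteq> (\<lambda>i. p * i) ` {1..N ^ 2 div p}"
    proof
      fix n assume "n \<in> ?M p"
      then obtain i where "n = p * i" "1 \<le> n" "n \<le> N ^ 2" by auto
      with p show "n \<in> (\<lambda>i. p * i) ` {1..N ^ 2 div p}"
        by (intro image_eqI[of _ _ i]) (auto simp: less_eq_div_iff_mult_less_eq prime_gt_0_nat mult.commute Suc_le_eq)
    qed
    then have "card (?M p) \<le> N ^ 2 div p"
      using surj_card_le[of "{1..N ^ 2 div p}" "?M p" "\<lambda>i. p * i"] by simp
    then have "real (card (?M p)) \<le> real (N ^ 2 div p)" by simp
    also have "\<dots> \<le> real (N ^ 2) / real p" by (rule of_nat_div_le_of_nat)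
    finally show "real (card (?M p)) \<le> real (N ^ 2) * ?f p" using p by simp
  qed
  also have "\<dots> = real (N ^ 2) * sum ?f ?I" by (simp only: sum_distrib_left)
  also have "sum ?f ?I = sum ?f {m..<Suc (N ^ 2)}"
    by (rule sum.mono_neutral_left) auto
  also have "real (N ^ 2) * sum ?f {m..<Suc (N ^ 2)} \<le> real (N ^ 2) * (1 / 2)"
    using m[of "Suc (N ^ 2)"] by (intro mult_left_mono) auto
  finally have "real (N ^ 2) \<le> 2 * real (2 ^ m * N)" by simp
  then show False by (simp add: N_def power2_eq_square)
qed

section \<open>Primes with a given number of digits\<close>

text \<open>Primes with \<open>k\<close> digits are at least \<open>B ^ (k - 1)\<close>. If there
  were at most \<open>M\<close> of them for every \<open>k \<ge> K\<close>, their reciprocals would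
  sum to at most \<open>M * B / B ^ k\<close>, and a geometric series would bound the sum over all
  primes.\<close>

lemma unbounded_card_primes_floorlog:
  assumes "B > 1"
  obtains k where "k \<ge> K" "M < card {p. prime p \<and> floorlog B p = k}"
proof -
  let ?f = "\<lambda>p::nat. if prime p then 1 / real p else 0"
  let ?X = "\<lambda>k. {p::nat. prime p \<and> floorlog B p = k}"
  define g where "g k = sum ?f (?X k)" for k
  have bd: "p < B ^ k \<and> B ^ k \<le> B * p" if "p \<in> ?X k" for p k
    using that floorlog_bounds[of p B] assms prime_gt_0_nat[of p]
    by (cases k) auto
  have fin: "finite (?X k)" for k
    using bd[of _ k] by (auto intro: finite_subset[of _ "{..<B ^ k}"])
  have "summable g" if le: "\<forall>k\<ge>K. card (?X k) \<le> M"
  proof (rule summable_comparison_test)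
    show "summable (\<lambda>k. real (M * B) * (1 / real B) ^ k)"
      using assms by (intro summable_mult summable_geometric) auto
    show "\<exists>N. \<forall>k\<ge>N. norm (g k) \<le> real (M * B) * (1 / real B) ^ k"
    proof (intro exI allI impI)
      fix k assume k: "k \<ge> K"
      have "g k \<le> real (card (?X k)) * (real B * (1 / real B) ^ k)"
        unfolding g_def
      proof (rule sum_bounded_above)
        fix p assume p: "p \<in> ?X k"
        have "real (B ^ k) \<le> real (B * p)" using bd[OF p] by (simp only: of_nat_le_iff)
        then have "1 / real p \<le> real B / real B ^ k"
          using p assms prime_gt_0_nat[of p] by (simp add: field_simps)
        then show "?f p \<le> real B * (1 / real B) ^ k"
          using p by (simp add: power_divide)
      qed
      also have "\<dots> \<le> real M * (real B * (1 / real B) ^ k)"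
        using le k by (intro mult_right_mono) auto
      finally show "norm (g k) \<le> real (M * B) * (1 / real B) ^ k"
        by (simp add: g_def sum_nonneg mult_ac)
    qed
  qed
  moreover have "summable ?f" if "summable g"
  proof (rule summableI_nonneg_bounded)
    fix n :: nat
    let ?P = "{p. prime p \<and> p < n}"
    have "sum ?f {..<n} = sum ?f ?P"
      by (rule sum.mono_neutral_right) auto
    \<comment> \<open>The primes below \<open>n\<close> are grouped by digit count; each group is
      part of the one that \<open>g k\<close> sums over.\<close>
    also have "\<dots> = (\<Sum>k\<le>floorlog B n. sum ?f {p \<in> ?P. floorlog B p = k})"
      by (rule sum.group[symmetric]) (auto intro: floorlog_mono)
    also have "\<dots> \<le> (\<Sum>k\<le>floorlog B n. g k)"
      unfolding g_def by (intro sum_mono sum_mono2 fin) auto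
    also have "\<dots> \<le> suminf g"
      by (intro sum_le_suminf that) (simp_all add: g_def sum_nonneg)
    finally show "sum ?f {..<n} \<le> suminf g" .
  qed simp
  ultimately show ?thesis
    using not_summable_prime_reciprocals that by (meson not_le_imp_less)
qed

section \<open>Polynomial values at \<open>B ^ k - 1\<close>\<close>

text \<open>The second variable allows the bound at \<open>B ^ k - 1\<close> to be a power of
  \<open>B ^ k\<close>.\<close>

lemma abs_poly_le:
  fixes P :: "int poly"
  assumes "0 \<le> x" "x \<le> y" "1 \<le> y"
  shows "\<bar>poly P x\<bar> \<le> (\<Sum>i\<le>degree P. \<bar>Polynomial.coeff P i\<bar>) * y ^ degree P"
proof -
  have "\<bar>poly P x\<bar> \<le> (\<Sum>i\<le>degree P. \<bar>Polynomial.coeff P i * x ^ i\<bar>)"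
    unfolding poly_altdef by (rule sum_abs)
  also have "\<dots> \<le> (\<Sum>i\<le>degree P. \<bar>Polynomial.coeff P i\<bar> * y ^ degree P)"
  proof (rule sum_mono)
    fix i assume "i \<in> {..degree P}"
    then have "x ^ i \<le> y ^ degree P"
      using assms by (intro order_trans[OF power_mono[of x y i] power_increasing]) auto
    then show "\<bar>Polynomial.coeff P i * x ^ i\<bar> \<le> \<bar>Polynomial.coeff P i\<bar> * y ^ degree P"
      using assms by (simp add: abs_mult mult_left_mono)
  qed
  finally show ?thesis by (simp add: sum_distrib_right)
qed

text \<open>Otherwise, for large \<open>k\<close>, the product of the primes with \<open>k\<close>
  digits divides a nonzero integer of size at most \<open>B ^ (k * (d + 1))\<close>. Each factor is
  at least \<open>B ^ (k - 1)\<close>, so there are at most \<open>2 * (d + 1)\<close> of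
  them.\<close>

lemma infinite_primes_not_dvd_poly_power:
  fixes P :: "int poly"
  assumes "B > 1" "P \<noteq> 0"
  shows "infinite {p. prime p \<and> \<not> int p dvd poly P (int B ^ floorlog B p - 1)}"
proof
  let ?S = "{p. prime p \<and> \<not> int p dvd poly P (int B ^ floorlog B p - 1)}"
  assume "finite ?S"
  then have "bdd_above (floorlog B ` ?S)" by (intro bdd_above_finite finite_imageI)
  then obtain K1 where K1: "floorlog B p \<le> K1" if "p \<in> ?S" for p
    by (auto simp: bdd_above_def)
  let ?Z = "{k. poly P (int B ^ k - 1) = 0}"
  \<comment> \<open>The map is injective as \<open>B > 1\<close>, so the finitely many roots of
    \<open>P\<close> are hit by finitely many \<open>k\<close>.\<close>
  have "finite ((\<lambda>k. int B ^ k - 1) -` {x. poly P x = 0})"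
    using assms by (intro finite_vimageI poly_roots_finite) (auto simp: inj_def)
  then have "bdd_above ?Z" by (intro bdd_above_finite) (simp add: vimage_def)
  then obtain K2 where K2: "k \<le> K2" if "k \<in> ?Z" for k
    by (auto simp: bdd_above_def)
  define C where "C = (\<Sum>i\<le>degree P. \<bar>Polynomial.coeff P i\<bar>)"
  define d where "d = degree P"
  \<comment> \<open>Beyond \<open>K1\<close> no prime with \<open>k\<close> digits is exceptional,
    beyond \<open>K2\<close> the value is nonzero, \<open>C \<le> k\<close> gives
    \<open>C \<le> B ^ k\<close>, and \<open>k \<ge> 2\<close> gives
    \<open>k \<le> 2 * (k - 1)\<close>.\<close>
  obtain k where k: "k \<ge> K1 + K2 + nat C + 2"
    and card: "2 * (d + 1) < card {p. prime p \<and> floorlog B p = k}"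
    using unbounded_card_primes_floorlog[OF assms(1)] .
  let ?X = "{p. prime p \<and> floorlog B p = k}"
  define v where "v = nat \<bar>poly P (int B ^ k - 1)\<bar>"
  have "v \<noteq> 0" using K2[of k] k by (auto simp: v_def)
  have "[v = 0] (mod \<Prod>?X)"
  proof (rule cong_cong_prod_coprime_nat)
    show "\<forall>p\<in>?X. [v = 0] (mod p)"
    proof
      fix p assume p: "p \<in> ?X"
      then have "p \<notin> ?S" using K1[of p] k by auto
      with p have "int p dvd poly P (int B ^ k - 1)" by simp
      then show "[v = 0] (mod p)" by (simp add: v_def cong_0_iff nat_dvd_iff)
    qed
  qed (auto simp: primes_coprime)
  then have "\<Prod>?X dvd v" by (simp only: cong_0_iff)
  have "(B ^ (k - 1)) ^ card ?X = (\<Prod>p\<in>?X. B ^ (k - 1))" by simp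
  also have "\<dots> \<le> \<Prod>?X"
  proof (rule prod_mono)
    fix p assume "p \<in> ?X"
    then show "0 \<le> B ^ (k - 1) \<and> B ^ (k - 1) \<le> p"
      using floorlog_bounds[of p B] assms prime_gt_0_nat[of p] by simp
  qed
  also have "\<dots> \<le> v" using \<open>\<Prod>?X dvd v\<close> \<open>v \<noteq> 0\<close> by (intro dvd_imp_le) auto
  \<comment> \<open>The exponent \<open>d + 1\<close> instead of \<open>d\<close> absorbs the
    constant \<open>C\<close>.\<close>
  also have "v \<le> B ^ (k * (d + 1))"
  proof -
    have "C \<le> int k" using k by simp
    also have "int k \<le> int (B ^ k)"
      using less_imp_le[OF power_gt_expt[of B k]] assms by (simp del: of_nat_power)
    finally have "C \<le> int (B ^ k)" .
    have "\<bar>poly P (int B ^ k - 1)\<bar> \<le> C * int (B ^ k) ^ d"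
      unfolding C_def d_def using assms by (intro abs_poly_le) auto
    also have "\<dots> \<le> int (B ^ k) * int (B ^ k) ^ d"
      using \<open>C \<le> int (B ^ k)\<close> by (intro mult_right_mono) auto
    finally have "int v \<le> int (B ^ (k * (d + 1)))"
      by (simp add: v_def power_add distrib_left flip: power_mult)
    then show ?thesis by (simp only: of_nat_le_iff)
  qed
  finally have "(k - 1) * card ?X \<le> k * (d + 1)"
    using assms by (simp flip: power_mult add: power_increasing_iff)
  also have "\<dots> \<le> (k - 1) * (2 * (d + 1))"
  proof -
    have "k \<le> (k - 1) * 2" using k by simp
    then show ?thesis by (metis mult.assoc mult_le_mono1)
  qed
  finally have "card ?X \<le> 2 * (d + 1)"
    using k by (subst (asm) mult_le_cancel1) simp
  with card show False by simp
qed

section \<open>From polynomial relations in \<open>ring_A\<close> to divisibility\<close>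

lemma class_A_zero: "class_A (\<lambda>p. 0) = \<zero>\<^bsub>ring_A\<^esub>"
proof -
  interpret A: cring ring_A by (rule cring_ring_A)
  show ?thesis
    using class_A_add[of "\<lambda>p. 0" "\<lambda>p. 0"] class_A_closed
    by (metis A.add.r_cancel_one add.right_neutral)
qed

lemma class_A_power: "class_A a [^]\<^bsub>ring_A\<^esub> (n::nat) = class_A (\<lambda>p. a p ^ n)"
proof -
  interpret A: cring ring_A by (rule cring_ring_A)
  show ?thesis
    by (induction n) (simp_all add: class_A_one class_A_mult mult.commute)
qed

lemma class_A_sum:
  assumes "finite I"
  shows "(\<Oplus>\<^bsub>ring_A\<^esub>i\<in>I. class_A (f i)) = class_A (\<lambda>p. \<Sum>i\<in>I. f i p)"
proof -
  interpret A: cring ring_A by (rule cring_ring_A)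
  show ?thesis
    using assms
    by (induction I) (simp_all add: class_A_zero class_A_closed class_A_add)
qed

lemma rat_to_A_of_int: "rat_to_A (of_int a) = class_A (\<lambda>p. a)"
  by (rule rat_to_A_eqI[of 1 _ a "{}"]) simp_all

lemma common_denominator:
  fixes f :: "'i \<Rightarrow> rat"
  assumes "finite I"
  obtains D :: int and c where "D \<noteq> 0" "\<And>i. i \<in> I \<Longrightarrow> of_int D * f i = of_int (c i)"
proof -
  have "\<exists>D c. D \<noteq> 0 \<and> (\<forall>i\<in>I. of_int D * f i = of_int (c i))"
    using assms
  proof (induction I)
    case (insert j I)
    then obtain D c where D: "D \<noteq> 0" "\<forall>i\<in>I. of_int D * f i = of_int (c i)" by blast
    obtain a b where ab: "b > 0" "f j = of_int a / of_int b"
      using quotient_of_div quotient_of_denom_pos by (metis surj_pair)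
    show ?case
      using D ab insert.hyps
      \<comment> \<open>The old denominator is multiplied by that of the new entry, which scales the
        old numerators by \<open>b\<close>.\<close>
      by (intro exI[of _ "b * D"] exI[of _ "\<lambda>i. if i = j then D * a else b * c i"]) auto
  qed (auto intro: exI[of _ 1])
  then show ?thesis using that by blast
qed

text \<open>Multiplying a rational relation by a common denominator gives an integer polynomial
  \<open>P\<close>. By \<open>class_A_eq_iff\<close>, vanishing of its value in
  \<open>ring_A\<close> means that all but finitely many \<open>p\<close> divide
  \<open>P (a p)\<close>.\<close>

lemma naively_transcendental_class_A:
  assumes "\<And>P :: int poly. P \<noteq> 0 \<Longrightarrow> infinite {p. prime p \<and> \<not> int p dvd poly P (a p)}"
  shows "naively_transcendental (class_A a)"
  unfolding naively_transcendental_def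
proof (intro conjI notI class_A_closed, elim bexE)
  interpret A: cring ring_A by (rule cring_ring_A)
  interpret U: UP_cring rat_ring "UP rat_ring"
    by (intro UP_cring.intro cring_from_type_algebra) 
  interpret H: ring_hom_cring rat_ring ring_A rat_to_A
    by (intro ring_hom_cring.intro ring_hom_cring_axioms.intro
        rat_to_A_ring_hom cring_ring_A cring_from_type_algebra)
  fix F
  assume F: "F \<in> carrier (UP rat_ring) - {\<zero>\<^bsub>UP rat_ring\<^esub>}"
    and root: "UnivPoly.eval rat_ring ring_A rat_to_A (class_A a) F = \<zero>\<^bsub>ring_A\<^esub>"
  define n where "n = deg rat_ring F"
  define f where "f i = up_ring.coeff (UP rat_ring) F i" for i
  obtain D c where D: "D \<noteq> 0" "\<And>i. i \<in> {..n} \<Longrightarrow> of_int D * f i = of_int (c i)"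
    using common_denominator[of "{..n}" f] by auto
  define P where "P = (\<Sum>i\<le>n. Polynomial.monom (c i) i)"
  have carr [simp]: "x \<in> carrier rat_ring" for x by (simp add: ring_of_type_algebra_def)
  have zero: "\<zero>\<^bsub>rat_ring\<^esub> = 0" by (simp add: ring_of_type_algebra_def)
  \<comment> \<open>This coefficient stays nonzero after scaling by \<open>D\<close>, whence
    \<open>P \<noteq> 0\<close>.\<close>
  have "\<exists>i\<le>n. f i \<noteq> 0"
  proof (rule ccontr)
    assume "\<not> (\<exists>i\<le>n. f i \<noteq> 0)"
    moreover have "f i = 0" if "i > n" for i
      using U.deg_aboveD[of F i] F that by (simp add: f_def n_def zero)
    ultimately have "f i = 0" for i by (metis not_le)
    then have "F = \<zero>\<^bsub>UP rat_ring\<^esub>"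
      using F by (intro U.up_eqI) (simp_all add: f_def zero)
    with F show False by simp
  qed
  then obtain i where i: "i \<le> n" "f i \<noteq> 0" by blast
  have "Polynomial.coeff P i = c i"
    using i by (simp add: P_def Polynomial.coeff_sum)
  moreover have "c i \<noteq> 0" using D(1) D(2)[of i] i by auto
  ultimately have "P \<noteq> 0" by auto
  have closed: "rat_to_A x \<in> carrier ring_A" for x by (rule H.hom_closed) simp
  have eq: "rat_to_A (of_int D) \<otimes>\<^bsub>ring_A\<^esub> rat_to_A (f i) = class_A (\<lambda>p. c i)" if "i \<le> n" for i
    using D(2)[of i] that H.hom_mult[of "of_int D" "f i"]
    by (simp add: ring_of_type_algebra_def rat_to_A_of_int)
  have sum_zero: "(\<Oplus>\<^bsub>ring_A\<^esub>i\<in>{..n}. rat_to_A (f i) \<otimes>\<^bsub>ring_A\<^esub> class_A a [^]\<^bsub>ring_A\<^esub> i) = \<zero>\<^bsub>ring_A\<^esub>"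
    using root F U.eval_on_carrier[of F ring_A rat_to_A "class_A a"]
    by (simp add: f_def n_def)
  \<comment> \<open>Scaling the relation by \<open>D\<close> turns each coefficient into the class
    of a constant integer, so everything can be computed on representatives.\<close>
  have "\<zero>\<^bsub>ring_A\<^esub> = rat_to_A (of_int D) \<otimes>\<^bsub>ring_A\<^esub>
      (\<Oplus>\<^bsub>ring_A\<^esub>i\<in>{..n}. rat_to_A (f i) \<otimes>\<^bsub>ring_A\<^esub> class_A a [^]\<^bsub>ring_A\<^esub> i)"
    unfolding sum_zero by (rule A.r_null[OF closed, symmetric])
  also have "\<dots> = (\<Oplus>\<^bsub>ring_A\<^esub>i\<in>{..n}. rat_to_A (of_int D) \<otimes>\<^bsub>ring_A\<^esub>
      (rat_to_A (f i) \<otimes>\<^bsub>ring_A\<^esub> class_A a [^]\<^bsub>ring_A\<^esub> i))"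
    using closed class_A_closed by (intro A.finsum_rdistr) auto
  also have "\<dots> = (\<Oplus>\<^bsub>ring_A\<^esub>i\<in>{..n}. class_A (\<lambda>p. c i * a p ^ i))"
    using closed class_A_closed
    by (intro A.finsum_cong')
      (simp_all add: A.m_assoc[symmetric] eq class_A_power class_A_mult)
  also have "\<dots> = class_A (\<lambda>p. poly P (a p))"
    by (simp add: class_A_sum P_def poly_sum poly_monom)
  finally have "finite {p. prime p \<and> \<not> [poly P (a p) = 0] (mod int p)}"
    by (simp add: class_A_zero[symmetric] class_A_eq_iff[symmetric])
  then show False
    using assms[OF \<open>P \<noteq> 0\<close>] by (simp add: cong_0_iff)
qed

theorem corollary4p3:
  fixes B :: nat
  assumes "B > 1"
  shows "naively_transcendental (image_A (\<lambda>p. digit_flip B p))"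
proof -
  have "[int (digit_flip B p) = int B ^ floorlog B p - 1] (mod int p)" if "prime p" for p
  proof -
    have "int (digit_flip B p + p + 1) = int (B ^ floorlog B p)"
      using digit_flip_add[OF assms prime_gt_0_nat[OF that]] by simp
    then have "int B ^ floorlog B p - 1 - int (digit_flip B p) = int p" by simp
    then show ?thesis by (metis cong_iff_dvd_diff cong_sym dvd_refl)
  qed
  then have "{p. prime p \<and> \<not> [int (digit_flip B p) = int B ^ floorlog B p - 1] (mod int p)} = {}"
    by auto
  \<comment> \<open>The representatives differ by exactly \<open>p\<close> at each prime, so the
    exceptional set is empty.\<close>
  then have "image_A (\<lambda>p. digit_flip B p) = class_A (\<lambda>p. int B ^ floorlog B p - 1)"
    unfolding image_A_def class_A_eq_iff by (simp only: finite.emptyI)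
  then show ?thesis
    using naively_transcendental_class_A infinite_primes_not_dvd_poly_power[OF assms] by simp
qed

end
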